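(* For all positive integers $n$ and $s$, $\hat g(n,s)\ge\max\{s,\sqrt{2ns}-3s/2\}$. Consequently $\hat g(n,s)\ge\Omega(s+\sqrt{ns})$.
   Context: Token game: played on an array $B$ with rows indexed by the positive integers and columns indexed by a finite list; each cell $B(i,u)$ is empty or contains a token. A token in $B(i,u)$ is grounded if all cells of column $u$ below it (rows $1,\ldots,i-1$) contain tokens; otherwise ungrounded. One column is the active column. A step, with active column $u$: if column $u$ contains grounded tokens, the player may optionally move the highest grounded token of column $u$ from its cell $B(i,u)$ to an empty cell $B(i',v)$ with $i'\le i$, provided no prior step moved a token between columns $u$ and $v$; then all ungrounded tokens in column $u$ shift down by one cell, and the active column advances cyclically. A step moving a token between columns is a transfer step. An $(n,s)$-token game is a token game with $n$ columns, each initially containing at most $s$ tokens. $\hat g(n,s)$ is the maximum number of tokens that can be placed in a single column in an $(n,s)$-token game. *)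

theory Defs
  imports Complex_Main "HOL-Library.Landau_Symbols"
begin

text \<open>
  \<^term>\<open>B i u\<close> says that the cell in row \<^term>\<open>i\<close> of column \<^term>\<open>u\<close> contains a token.  Rows are the
  positive integers and columns are the numbers in \<^term>\<open>{..<n}\<close>; an initial board has no token outside of
  this range, and steps preserve this.
\<close>

type_synonym board = "nat \<Rightarrow> nat \<Rightarrow> bool"

definition grounded :: "board \<Rightarrow> nat \<Rightarrow> nat \<Rightarrow> bool" where
  "grounded B i u \<longleftrightarrow> B i u \<and> (\<forall>j. 1 \<le> j \<and> j < i \<longrightarrow> B j u)"

definition highest_grounded :: "board \<Rightarrow> nat \<Rightarrow> nat \<Rightarrow> bool" where
  "highest_grounded B i u \<longleftrightarrow> grounded B i u \<and> (\<forall>j. grounded B j u \<longrightarrow> j \<le> i)"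

definition move_token :: "board \<Rightarrow> nat \<Rightarrow> nat \<Rightarrow> nat \<Rightarrow> nat \<Rightarrow> board" where
  "move_token B i u i' v =
     (\<lambda>j w. if j = i \<and> w = u then False else if j = i' \<and> w = v then True else B j w)"

definition shift_down :: "board \<Rightarrow> nat \<Rightarrow> board" where
  "shift_down B u =
     (\<lambda>j w. if w = u then grounded B j u \<or> (B (Suc j) u \<and> \<not> grounded B (Suc j) u) else B j w)"

text \<open>
  A state consists of the board, the active column, and the set of the unordered pairs of columns
  between which (in either direction) a token has been moved so far.
\<close>

type_synonym game_state = "board \<times> nat \<times> nat set set"

inductive token_step :: "nat \<Rightarrow> game_state \<Rightarrow> game_state \<Rightarrow> bool" for n :: nat where
  no_transfer:
    "u < n \<Longrightarrow> token_step n (B, u, P) (shift_down B u, Suc u mod n, P)"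
| transfer:
    "u < n \<Longrightarrow> v < n \<Longrightarrow> v \<noteq> u \<Longrightarrow> highest_grounded B i u \<Longrightarrow> 1 \<le> i' \<Longrightarrow> i' \<le> i \<Longrightarrow> \<not> B i' v \<Longrightarrow>
     {u, v} \<notin> P \<Longrightarrow>
     token_step n (B, u, P) (shift_down (move_token B i u i' v) u, Suc u mod n, insert {u, v} P)"

definition column_tokens :: "board \<Rightarrow> nat \<Rightarrow> nat set" where
  "column_tokens B u = {i. B i u}"

definition initial_board :: "nat \<Rightarrow> nat \<Rightarrow> board \<Rightarrow> bool" where
  "initial_board n s B \<longleftrightarrow>
     (\<forall>i u. B i u \<longrightarrow> 1 \<le> i \<and> u < n) \<and>
     (\<forall>u<n. finite (column_tokens B u) \<and> card (column_tokens B u) \<le> s)"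

definition reachable :: "nat \<Rightarrow> nat \<Rightarrow> board \<Rightarrow> bool" where
  "reachable n s B \<longleftrightarrow>
     (\<exists>B\<^sub>0 u\<^sub>0 u P. initial_board n s B\<^sub>0 \<and> u\<^sub>0 < n \<and> (token_step n)\<^sup>*\<^sup>* (B\<^sub>0, u\<^sub>0, {}) (B, u, P))"

definition column_counts :: "nat \<Rightarrow> nat \<Rightarrow> nat set" where
  "column_counts n s = {card (column_tokens B v) | B v. reachable n s B \<and> v < n}"

definition ghat :: "nat \<Rightarrow> nat \<Rightarrow> nat" where
  "ghat n s = Max (column_counts n s)"

text \<open>The set of counts is finite and nonempty: no step creates tokens, so there are never more than
  \<^term>\<open>n * s\<close> of them.\<close>

lemma card_shift_down:
  assumes "finite {(i, w). B i w}"
  shows "finite {(i, w). shift_down B u i w} \<and>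
         card {(i, w). shift_down B u i w} \<le> card {(i, w). B i w}"
proof -
  let ?f = "\<lambda>(i, w). if w = u \<and> \<not> grounded B i u then (i - 1, w) else (i, w)"
  have "p \<in> ?f ` {(i, w). B i w}" if "p \<in> {(i, w). shift_down B u i w}" for p
  proof -
    obtain j w where p: "p = (j, w)" by (cases p)
    consider "w \<noteq> u" "B j w" | "w = u" "grounded B j u"
      | "w = u" "B (Suc j) u" "\<not> grounded B (Suc j) u"
      using \<open>p \<in> _\<close> by (auto simp: p shift_down_def split: if_splits)
    then show ?thesis
    proof cases
      case 1
      then show ?thesis by (intro image_eqI[of _ _ "(j, w)"]) (auto simp: p)
    next
      case 2
      then show ?thesis by (intro image_eqI[of _ _ "(j, w)"]) (auto simp: p grounded_def)
    next
      case 3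
      then show ?thesis by (intro image_eqI[of _ _ "(Suc j, w)"]) (auto simp: p)
    qed
  qed
  then have "{(i, w). shift_down B u i w} \<subseteq> ?f ` {(i, w). B i w}" by blast
  then show ?thesis
    by (meson assms card_image_le card_mono finite_imageI finite_subset le_trans)
qed

lemma card_move_token:
  assumes "finite {(j, w). B j w}" "B i u"
  shows "finite {(j, w). move_token B i u i' v j w} \<and>
         card {(j, w). move_token B i u i' v j w} \<le> card {(j, w). B j w}"
proof -
  let ?A = "{(j, w). B j w}"
  have sub: "{(j, w). move_token B i u i' v j w} \<subseteq> insert (i', v) (?A - {(i, u)})"
    by (auto simp: move_token_def split: if_splits)
  have fin: "finite (insert (i', v) (?A - {(i, u)}))"
    using assms(1) by simp
  have "card (insert (i', v) (?A - {(i, u)})) \<le> Suc (card (?A - {(i, u)}))"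
    by (rule card_insert_le_m1) auto
  also have "\<dots> = card ?A"
    using assms by (intro card.remove[symmetric]) auto
  finally show ?thesis
    using sub fin by (meson card_mono finite_subset le_trans)
qed

lemma card_token_step:
  assumes "token_step n (B, u, P) (B', u', P')" "finite {(j, w). B j w}"
  shows "finite {(j, w). B' j w} \<and> card {(j, w). B' j w} \<le> card {(j, w). B j w}"
  using assms(1)
proof cases
  case no_transfer
  then show ?thesis using card_shift_down[OF assms(2)] by simp
next
  case (transfer v i i')
  then have "B i u" by (simp add: highest_grounded_def grounded_def)
  from card_move_token[where i'=i' and v=v, OF assms(2) this]
  show ?thesis using transfer card_shift_down[where B="move_token B i u i' v" and u=u]
    by (meson le_trans)
qed

lemma card_token_steps:
  assumes "(token_step n)\<^sup>*\<^sup>* S S'" "finite {(j, w). fst S j w}"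
  shows "finite {(j, w). fst S' j w} \<and> card {(j, w). fst S' j w} \<le> card {(j, w). fst S j w}"
  using assms
proof (induction rule: rtranclp_induct)
  case base
  then show ?case by simp
next
  case (step S' S'')
  then show ?case
    using card_token_step[of n "fst S'" "fst (snd S')" "snd (snd S')"
        "fst S''" "fst (snd S'')" "snd (snd S'')"] by fastforce
qed

lemma card_initial_board:
  assumes "initial_board n s B"
  shows "finite {(j, w). B j w} \<and> card {(j, w). B j w} \<le> n * s"
proof -
  have eq: "{(j, w). B j w} = (\<Union>w\<in>{..<n}. (\<lambda>j. (j, w)) ` column_tokens B w)"
    using assms by (auto simp: initial_board_def column_tokens_def)
  have fin: "finite (column_tokens B w)" "card (column_tokens B w) \<le> s" if "w < n" for w
    using assms that by (auto simp: initial_board_def)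
  have "card {(j, w). B j w} \<le> (\<Sum>w<n. card ((\<lambda>j. (j, w)) ` column_tokens B w))"
    unfolding eq by (intro card_UN_le) auto
  also have "\<dots> \<le> (\<Sum>w<n. s)"
    using fin by (intro sum_mono) (meson card_image_le lessThan_iff le_trans)
  finally show ?thesis using fin eq by simp
qed

lemma column_counts_le:
  assumes "k \<in> column_counts n s"
  shows "k \<le> n * s"
proof -
  obtain B v where B: "k = card (column_tokens B v)" "reachable n s B"
    using assms by (auto simp: column_counts_def)
  then obtain B0 u0 u P where B0: "initial_board n s B0"
    and steps: "(token_step n)\<^sup>*\<^sup>* (B0, u0, {}) (B, u, P)"
    by (auto simp: reachable_def)
  have fin: "finite {(j, w). B j w}" and le: "card {(j, w). B j w} \<le> n * s"
    using card_token_steps[OF steps] card_initial_board[OF B0] by auto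
  have "k = card ((\<lambda>j. (j, v)) ` column_tokens B v)"
    by (simp add: B card_image inj_on_def)
  also have "\<dots> \<le> card {(j, w). B j w}"
    using fin by (intro card_mono) (auto simp: column_tokens_def)
  finally show ?thesis using le by simp
qed

lemma finite_column_counts: "finite (column_counts n s)"
  by (rule finite_subset[of _ "{..n * s}"]) (auto dest: column_counts_le)

lemma column_counts_nonempty:
  assumes "n \<ge> 1"
  shows "column_counts n s \<noteq> {}"
proof -
  have "reachable n s (\<lambda>_ _. False)"
    unfolding reachable_def
    by (rule exI[of _ "\<lambda>_ _. False"], rule exI[of _ 0], rule exI[of _ 0], rule exI[of _ "{}"])
      (use assms in \<open>auto simp: initial_board_def column_tokens_def\<close>)
  moreover have "0 < n" using assms by simp
  ultimately show ?thesis unfolding column_counts_def by blast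
qed

end

theory Submission
  imports Defs
begin

text \<open>
  The columns are arranged in batches: batch \<open>b\<close> has \<open>(b + 1) s\<close> columns, whose
  heights are to become \<open>(b + 1) s, \<dots>, 2, 1\<close>.  A staircase of columns with heights \<open>1, \<dots>, b s\<close>
  fills rows \<open>1, \<dots>, b s\<close> of a column whose own \<open>s\<close> tokens lie just above, in a single round
  (one active turn of every column); this lowers the staircase by one, so that in the following rounds it
  can fill \<open>b s - 1, b s - 2, \<dots>\<close> rows of further columns, each pair of columns being used at
  most once.  The own tokens of a column start so high that they have fallen to the right rows when it
  is its turn to be filled.  With \<open>s t (t + 1) / 2\<close> columns there are \<open>t\<close> complete batches,
  the last of which has a column with \<open>t s\<close> tokens.
\<close>

section \<open>Downward shift of solid and of floating columns\<close>

lemma shift_down_full: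
  assumes "\<And>i. B i u \<longleftrightarrow> 1 \<le> i \<and> i \<le> m"
  shows "shift_down B u = B"
  by (intro ext) (auto simp: shift_down_def grounded_def assms)

text \<open>With row 1 empty nothing is grounded, so the whole column falls. Row 0 is excluded too,
  since a token there would be grounded vacuously.\<close>

lemma shift_down_falling:
  assumes "\<not> B 0 u" "\<not> B (Suc 0) u"
  shows "shift_down B u = (\<lambda>i w. if w = u then B (Suc i) u else B i w)"
proof -
  have "\<not> grounded B i u" for i
    using assms by (cases "i = 0 \<or> i = 1") (auto simp: grounded_def)
  then show ?thesis by (auto simp: shift_down_def)
qed

section \<open>Arithmetic of the batches\<close>

primrec batch_start :: "nat \<Rightarrow> nat \<Rightarrow> nat" where
  "batch_start s 0 = 0"
| "batch_start s (Suc b) = batch_start s b + Suc b * s"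

lemma batch_start_mono: "b \<le> b' \<Longrightarrow> batch_start s b \<le> batch_start s b'"
  by (induction b' rule: nat_induct) (auto simp: le_Suc_eq)

lemma batch_start_eq: "2 * batch_start s b = s * b * (b + 1)"
  by (induction b) (auto simp: algebra_simps)

lemma le_batch_start: "s \<ge> 1 \<Longrightarrow> b \<le> batch_start s b"
proof (induction b)
  case (Suc b)
  have "1 * 1 \<le> Suc b * s" using Suc.prems by (intro mult_le_mono) auto
  with Suc show ?case unfolding batch_start.simps by linarith
qed simp

definition batch :: "nat \<Rightarrow> nat \<Rightarrow> nat" where
  "batch s c = (LEAST b. c < batch_start s (Suc b))"

definition pos :: "nat \<Rightarrow> nat \<Rightarrow> nat" where
  "pos s c = c - batch_start s (batch s c)"

lemma batch_start_batch_le: "batch_start s (batch s c) \<le> c"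
proof (cases "batch s c")
  case (Suc b)
  then have "b < (LEAST b. c < batch_start s (Suc b))" by (simp add: batch_def)
  from not_less_Least[OF this] show ?thesis by (simp add: Suc)
qed simp

lemma column_eq: "c = batch_start s (batch s c) + pos s c"
  using batch_start_batch_le[of s c] by (simp add: pos_def)

lemma pos_less:
  assumes "s \<ge> 1"
  shows "pos s c < Suc (batch s c) * s"
proof -
  \<comment> \<open>\<open>c\<close> itself witnesses that the \<open>LEAST\<close> in
    \<open>batch\<close> is taken over a nonempty set.\<close>
  have "c < batch_start s (Suc c)" using le_batch_start[OF assms, of "Suc c"] by simp
  then have "c < batch_start s (Suc (batch s c))" unfolding batch_def by (rule LeastI)
  then show ?thesis using column_eq[of c s] by simp
qed

lemma batch_eqI:
  assumes "p < Suc b * s"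
  shows "batch s (batch_start s b + p) = b"
  unfolding batch_def
proof (rule Least_equality)
  show "batch_start s b + p < batch_start s (Suc b)" using assms by simp
  fix b' assume less: "batch_start s b + p < batch_start s (Suc b')"
  show "b \<le> b'"
    using less batch_start_mono[of "Suc b'" b s] by (cases "b \<le> b'") auto
qed

lemma pos_eqI: "p < Suc b * s \<Longrightarrow> pos s (batch_start s b + p) = p"
  by (simp add: pos_def batch_eqI)

section \<open>Schedule of the rounds and the board they produce\<close>

locale staircase =
  fixes n s t :: nat
  assumes s_pos: "s \<ge> 1" and t_pos: "t \<ge> 1" and enough_columns: "batch_start s t \<le> n"
begin

definition N :: nat where "N = t * s"

text \<open>Time is cut into phases of \<open>N\<close> rounds: batch \<open>b\<close> is scheduled
  to be filled in phase \<open>b\<close>, one column per round, and to give its tokens away in phase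
  \<open>b + 1\<close>. \<open>N\<close> rounds suffice for every batch below
  \<open>t\<close>.\<close>

definition fill :: "nat \<Rightarrow> nat" where
  "fill c = batch s c * N + pos s c"

text \<open>
  The contents of column \<open>c\<close> at the beginning of round \<open>R\<close>.  In the round
  \<open>fill c\<close> the rows from \<open>1\<close> to \<open>batch s c * s - pos s c\<close> (none if the truncated
  subtraction gives \<open>0\<close>) are filled, and from round \<open>Suc (batch s c) * N\<close> on one token is given away in every round.
\<close>

definition held :: "nat \<Rightarrow> nat \<Rightarrow> nat \<Rightarrow> bool" where
  "held R i c \<longleftrightarrow>
     (if R \<le> fill c
      then batch s c * s - pos s c + (fill c - R) < i \<and>
           i \<le> Suc (batch s c) * s - pos s c + (fill c - R)
      else 1 \<le> i \<and> i \<le> Suc (batch s c) * s - pos s c - (R - Suc (batch s c) * N))"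

text \<open>
  The last conjunct says that the column of the previous batch that supplies row \<open>i\<close>, namely the one
  whose height is \<open>i\<close> at the beginning of round \<open>R\<close>, has already been active in this round.
\<close>

definition received :: "nat \<Rightarrow> nat \<Rightarrow> nat \<Rightarrow> nat \<Rightarrow> bool" where
  "received R k i c \<longleftrightarrow>
     R = fill c \<and> 1 \<le> i \<and> i + pos s c \<le> batch s c * s \<and>
     batch_start s (batch s c - 1) + (batch s c * s - (i + pos s c)) < k"

text \<open>The board in round \<open>R\<close> when column \<open>k\<close> is about to become active.\<close>

definition board_at :: "nat \<Rightarrow> nat \<Rightarrow> board" where
  "board_at R k i c \<longleftrightarrow>
     c < n \<and> (if c < k then held (Suc R) i c else held R i c \<or> received R k i c)"

text \<open>Here \<open>u\<close> is the giver and \<open>v\<close> the receiver. The set ignores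
  whether \<open>u\<close> had a token to give, so it only bounds the pairs used from above;
  inclusion in it is the invariant.\<close>

definition used_pairs :: "nat \<Rightarrow> nat \<Rightarrow> nat set set" where
  "used_pairs R k =
     {{u, v} | u v. batch s v = Suc (batch s u) \<and> (fill v < R \<or> fill v = R \<and> u < k)}"

lemma Suc_batch_mult_le_N: "b < t \<Longrightarrow> Suc b * s \<le> N"
  unfolding N_def by (intro mult_le_mono1) simp

lemma N_pos: "N \<ge> 1"
  using s_pos t_pos by (simp add: N_def)

text \<open>Play stops after round \<open>(t - 1) * N\<close>, in which the first column of batch
  \<open>t - 1\<close> is filled. Later batches, possibly incomplete, never get their turn to be
  filled.\<close>

lemma phase_less:
  assumes "R \<le> (t - 1) * N" "b * N \<le> R"
  shows "b < t"
proof -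
  have "b * N \<le> (t - 1) * N" using assms by (rule order_trans[rotated])
  then have "b \<le> t - 1" using N_pos by (intro mult_right_le_imp_le[of b N]) auto
  then show ?thesis using t_pos by simp
qed

lemma fill_less:
  assumes "R \<le> (t - 1) * N" "fill c \<le> R"
  shows "fill c < Suc (batch s c) * N" "batch s c < t"
proof -
  have *: "batch s c < t"
    using assms by (intro phase_less[of R]) (auto simp: fill_def)
  show "batch s c < t" by fact
  show "fill c < Suc (batch s c) * N"
    using Suc_batch_mult_le_N[OF *] pos_less[OF s_pos, of c] by (simp add: fill_def)
qed

section \<open>Effect of a single turn\<close>

lemma received_Suc:
  assumes "received R (Suc k) i c" "\<not> received R k i c"
  shows "R = Suc (batch s k) * N + pos s c"
    and "batch s c = Suc (batch s k)"
    and "i + pos s c = Suc (batch s k) * s - pos s k"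
    and "1 \<le> i"
proof -
  let ?p = "batch s c * s - (i + pos s c)"
  \<comment> \<open>A cell becomes received exactly in the turn of its supplier, so the supplier is
    \<open>k\<close>.\<close>
  have r: "R = fill c" "1 \<le> i" "i + pos s c \<le> batch s c * s"
    "k = batch_start s (batch s c - 1) + ?p"
    using assms by (auto simp: received_def)
  then obtain b where b: "batch s c = Suc b" by (cases "batch s c") auto
  have p: "?p < Suc b * s" using r b by simp
  have k: "batch s k = b" "pos s k = ?p"
    using r(4) batch_eqI[OF p] pos_eqI[OF p] b by auto
  show "R = Suc (batch s k) * N + pos s c" "batch s c = Suc (batch s k)" "1 \<le> i"
    "i + pos s c = Suc (batch s k) * s - pos s k"
    using r k b by (auto simp: fill_def)
qed

text \<open>After \<open>r\<close> rounds of its giving phase, column \<open>k\<close> is solid of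
  height \<open>i\<close>. It passes its top token sideways, within row \<open>i\<close>, to
  position \<open>r\<close> of the next batch, the column filled in this round.\<close>

lemma step_transfer:
  assumes k: "k < n" and R: "R \<le> (t - 1) * N" and P: "P \<subseteq> used_pairs R k"
    and send: "R = Suc (batch s k) * N + r" "r < Suc (batch s k) * s - pos s k"
  shows "\<exists>P'. token_step n (board_at R k, k, P) (board_at R (Suc k), Suc k mod n, P') \<and>
              P' \<subseteq> used_pairs R (Suc k)"
proof -
  define b p where "b = batch s k" and "p = pos s k"
  define i where "i = Suc b * s - p - r"
  define v where "v = batch_start s (Suc b) + r"
  have p_less: "p < Suc b * s" using pos_less[OF s_pos] by (simp add: b_def p_def)
  have k_eq: "k = batch_start s b + p" by (simp add: b_def p_def flip: column_eq)
  have Sb: "Suc b < t" using phase_less[OF R] send by (simp add: b_def)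
  have r: "r < Suc b * s - p" using send by (simp add: b_def p_def)
  have r_less: "r < Suc (Suc b) * s" using r by simp
  have v: "batch s v = Suc b" "pos s v = r"
    unfolding v_def using batch_eqI[OF r_less] pos_eqI[OF r_less] by auto
  have kv: "k < v" using p_less by (simp add: v_def k_eq)
  have "v < batch_start s (Suc (Suc b))" using r_less by (simp add: v_def)
  also have "\<dots> \<le> batch_start s t" using Sb by (intro batch_start_mono) simp
  finally have vn: "v < n" using enough_columns by simp
  have fill_v: "fill v = R" using send by (simp add: fill_def v b_def)
  have "fill k < R"
    using send Suc_batch_mult_le_N[of b] Sb p_less by (auto simp: fill_def b_def p_def)
  then have col_k: "board_at R k j k \<longleftrightarrow> 1 \<le> j \<and> j \<le> i" for j
    using k send by (auto simp: board_at_def held_def received_def i_def b_def p_def)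
  have i_pos: "1 \<le> i" using r by (simp add: i_def)
  have ip: "i + r = Suc b * s - p" using r by (simp add: i_def)
  have hg: "highest_grounded (board_at R k) i k"
    using i_pos by (auto simp: highest_grounded_def grounded_def col_k)
  \<comment> \<open>The supplier of row \<open>i\<close> of \<open>v\<close> has position
    \<open>p\<close>, hence is \<open>k\<close>: the cell is missing before this turn and present
    after it.\<close>
  have "Suc b * s - (i + r) = p" using ip p_less by simp
  moreover have "i + r \<le> Suc b * s" using ip by simp
  ultimately have rec_v: "\<not> received R k i v" "received R (Suc k) i v"
    using i_pos fill_v k_eq by (auto simp: received_def v simp del: mult_Suc)
  have "\<not> held R i v" using ip fill_v by (auto simp: held_def v simp del: mult_Suc)
  with rec_v kv have emp: "\<not> board_at R k i v" by (simp add: board_at_def)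
  have new: "{k, v} \<notin> P"
  proof
    assume "{k, v} \<in> P"
    with P obtain u w where uw: "{k, v} = {u, w}" "batch s w = Suc (batch s u)"
      "fill w < R \<or> fill w = R \<and> u < k" by (auto simp: used_pairs_def)
    \<comment> \<open>The batch numbers rule out the second orientation, and the first would need
      \<open>k < k\<close>.\<close>
    then have "u = k \<and> w = v \<or> u = v \<and> w = k" by (auto simp: doubleton_eq_iff)
    then show False using uw v fill_v by (auto simp: b_def)
  qed
  let ?M = "move_token (board_at R k) i k i v"
  have "?M j k \<longleftrightarrow> 1 \<le> j \<and> j \<le> i - 1" for j
    using kv i_pos by (auto simp: move_token_def col_k)
  then have sd: "shift_down ?M k = ?M" by (rule shift_down_full)
  have eq: "?M = board_at R (Suc k)"
  proof (intro ext)
    fix j c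
    show "?M j c = board_at R (Suc k) j c"
    proof (cases "c = k")
      case True
      have "?M j k \<longleftrightarrow> 1 \<le> j \<and> j \<le> i - 1"
        using kv i_pos by (auto simp: move_token_def col_k)
      moreover have "board_at R (Suc k) j k \<longleftrightarrow> 1 \<le> j \<and> j \<le> i - 1"
        using k \<open>fill k < R\<close> send by (auto simp: board_at_def held_def i_def b_def p_def)
      ultimately show ?thesis using True by simp
    next
      case False
      \<comment> \<open>The turn of \<open>k\<close> makes no other cell received than row
        \<open>i\<close> of \<open>v\<close>.\<close>
      have "c = v \<and> j = i" if "received R (Suc k) j c" "\<not> received R k j c"
      proof -
        note new = received_Suc[OF that]
        have "pos s c = r" using new(1) send by simp
        moreover have "batch s c = Suc b" using new(2) by (simp add: b_def)
        ultimately have "c = v" using column_eq[of c s] by (simp only: v_def)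
        moreover have "j = i" using new(3) \<open>pos s c = r\<close> ip by (simp add: b_def p_def)
        ultimately show ?thesis by simp
      qed
      moreover have "received R (Suc k) j c" if "received R k j c"
        using that by (auto simp: received_def)
      ultimately have "received R (Suc k) j c \<longleftrightarrow> received R k j c \<or> c = v \<and> j = i"
        using rec_v(2) by blast
      then show ?thesis
        using False kv vn by (auto simp: move_token_def board_at_def less_Suc_eq)
    qed
  qed
  have "token_step n (board_at R k, k, P) (shift_down ?M k, Suc k mod n, insert {k, v} P)"
    using k vn kv hg i_pos emp new by (intro transfer) auto
  moreover have "insert {k, v} P \<subseteq> used_pairs R (Suc k)"
  proof -
    have "{k, v} \<in> used_pairs R (Suc k)"
      unfolding used_pairs_def using v fill_v by (auto simp: b_def)
    moreover have "used_pairs R k \<subseteq> used_pairs R (Suc k)"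
      unfolding used_pairs_def by fastforce
    ultimately show ?thesis using P by blast
  qed
  ultimately show ?thesis unfolding trans[OF sd eq] by (intro exI conjI)
qed

text \<open>Before its fill round the column falls by one row. From then on it is solid and its turn
  changes nothing: it is just completed, waiting to give, or already empty.\<close>

lemma step_no_transfer:
  assumes k: "k < n" and R: "R \<le> (t - 1) * N" and P: "P \<subseteq> used_pairs R k"
    and nosend: "\<not> (\<exists>r. R = Suc (batch s k) * N + r \<and> r < Suc (batch s k) * s - pos s k)"
  shows "\<exists>P'. token_step n (board_at R k, k, P) (board_at R (Suc k), Suc k mod n, P') \<and>
              P' \<subseteq> used_pairs R (Suc k)"
proof -
  define b p where "b = batch s k" and "p = pos s k"
  have p_less: "p < Suc b * s" using pos_less[OF s_pos] by (simp add: b_def p_def)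
  have k_eq: "k = batch_start s b + p" by (simp add: b_def p_def flip: column_eq)
  have rec: "received R (Suc k) j c = received R k j c" for j c
  proof
    assume *: "received R (Suc k) j c"
    show "received R k j c"
    proof (rule ccontr)
      assume "\<not> received R k j c"
      from received_Suc[OF * this] have "R = Suc (batch s k) * N + pos s c"
        "pos s c < Suc (batch s k) * s - pos s k" by auto
      then show False using nosend by blast
    qed
  qed (auto simp: received_def)
  have "shift_down (board_at R k) k j k = held (Suc R) j k" for j
  proof (cases "R < fill k")
    case True
    then have col: "board_at R k j k = held R j k" for j
      using k by (auto simp: board_at_def received_def)
    \<comment> \<open>Since \<open>fill k - R\<close> is positive, the tokens start in row 2 or
      higher.\<close>
    have "\<not> held R 0 k" "\<not> held R (Suc 0) k" using True by (auto simp: held_def)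
    moreover have "held R (Suc j) k = held (Suc R) j k"
      using True by (auto simp: held_def)
    ultimately show ?thesis using col by (simp add: shift_down_falling)
  next
    case False
    then have fl: "fill k < Suc b * N" "b < t" using fill_less[OF R, of k] by (auto simp: b_def)
    have "\<exists>m. \<forall>j. board_at R k j k = (1 \<le> j \<and> j \<le> m) \<and> held (Suc R) j k = (1 \<le> j \<and> j \<le> m)"
    proof (cases "R = fill k")
      case True
      \<comment> \<open>Suppliers lie in the preceding batch, so all have moved in this round before
        \<open>k\<close>. For \<open>b = 0\<close> there is no such row \<open>j\<close>.\<close>
      have "batch_start s (b - 1) + (b * s - (j + p)) < k"
        if "1 \<le> j" "j + p \<le> b * s" for j
        using that by (cases b) (auto simp: k_eq)
      then have "received R k j k \<longleftrightarrow> 1 \<le> j \<and> j + p \<le> b * s" for j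
        using True by (auto simp: received_def b_def p_def)
      moreover have "held R j k \<longleftrightarrow> b * s - p < j \<and> j \<le> Suc b * s - p" for j
        using True by (simp add: held_def b_def p_def)
      ultimately have "board_at R k j k \<longleftrightarrow> 1 \<le> j \<and> j \<le> Suc b * s - p" for j
        using k by (auto simp: board_at_def)
      moreover have "held (Suc R) j k \<longleftrightarrow> 1 \<le> j \<and> j \<le> Suc b * s - p" for j
        using True fl by (simp add: held_def b_def p_def del: mult_Suc)
      ultimately show ?thesis by blast
    next
      case neq: False
      \<comment> \<open>Giving has not begun or nothing is left; either way truncated subtraction
        keeps the height constant.\<close>
      have "Suc R \<le> Suc b * N \<or> Suc b * s - p \<le> R - Suc b * N"
      proof (rule ccontr)
        assume "\<not> ?thesis"
        then have "R = Suc b * N + (R - Suc b * N)" "R - Suc b * N < Suc b * s - p" by auto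
        then show False using nosend unfolding b_def p_def by blast
      qed
      then have "Suc b * s - p - (Suc R - Suc b * N) = Suc b * s - p - (R - Suc b * N)"
        by auto
      then have "held (Suc R) j k = held R j k" for j
        using False neq by (simp add: held_def b_def p_def del: mult_Suc)
      moreover have "board_at R k j k = held R j k" for j
        using k neq by (auto simp: board_at_def received_def)
      moreover have "held R j k \<longleftrightarrow> 1 \<le> j \<and> j \<le> Suc b * s - p - (R - Suc b * N)" for j
        using False neq by (simp add: held_def b_def p_def del: mult_Suc)
      ultimately show ?thesis by blast
    qed
    then obtain m where m: "\<And>j. board_at R k j k = (1 \<le> j \<and> j \<le> m)"
      "\<And>j. held (Suc R) j k = (1 \<le> j \<and> j \<le> m)" by blast
    show ?thesis using shift_down_full[of "board_at R k", OF m(1)] m by simp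
  qed
  then have "shift_down (board_at R k) k = board_at R (Suc k)"
    using k by (intro ext) (auto simp: board_at_def rec less_Suc_eq, auto simp: shift_down_def board_at_def)
  moreover have "used_pairs R k \<subseteq> used_pairs R (Suc k)"
    unfolding used_pairs_def by fastforce
  ultimately show ?thesis
    using no_transfer[OF k, of "board_at R k" P] P by (metis subset_trans)
qed

section \<open>Whole rounds and the final board\<close>

lemma board_at_Suc_round: "board_at R n = board_at (Suc R) 0"
  by (intro ext) (auto simp: board_at_def received_def)

lemma used_pairs_Suc_round: "used_pairs R n \<subseteq> used_pairs (Suc R) 0"
  unfolding used_pairs_def by fastforce

lemma steps_in_round:
  assumes "k \<le> n" "R \<le> (t - 1) * N"
    and "(token_step n)\<^sup>*\<^sup>* S (board_at R 0, 0, P)" "P \<subseteq> used_pairs R 0"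
  shows "\<exists>P'. (token_step n)\<^sup>*\<^sup>* S (board_at R k, k mod n, P') \<and> P' \<subseteq> used_pairs R k"
  using assms(1)
proof (induction k)
  case 0
  then show ?case using assms by auto
next
  case (Suc k)
  then obtain P' where P': "(token_step n)\<^sup>*\<^sup>* S (board_at R k, k, P')" "P' \<subseteq> used_pairs R k"
    by auto
  have "k < n" using Suc.prems by simp
  obtain P'' where "token_step n (board_at R k, k, P') (board_at R (Suc k), Suc k mod n, P'')"
    "P'' \<subseteq> used_pairs R (Suc k)"
    using step_transfer[OF \<open>k < n\<close> assms(2) P'(2)] step_no_transfer[OF \<open>k < n\<close> assms(2) P'(2)]
    by metis
  with P'(1) show ?case by (blast intro: rtranclp.rtrancl_into_rtrancl)
qed

lemma steps_to_round:
  assumes "R \<le> Suc ((t - 1) * N)"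
  shows "\<exists>P. (token_step n)\<^sup>*\<^sup>* (board_at 0 0, 0, {}) (board_at R 0, 0, P) \<and>
             P \<subseteq> used_pairs R 0"
  using assms
proof (induction R)
  case (Suc R)
  then obtain P where P: "(token_step n)\<^sup>*\<^sup>* (board_at 0 0, 0, {}) (board_at R 0, 0, P)"
    "P \<subseteq> used_pairs R 0" by auto
  from steps_in_round[OF order_refl _ P] Suc.prems show ?case
    using used_pairs_Suc_round[of R] by (auto simp flip: board_at_Suc_round)
qed auto

lemma initial: "initial_board n s (board_at 0 0)"
proof -
  have sub: "column_tokens (board_at 0 0) c \<subseteq>
      {batch s c * s - pos s c + fill c <.. Suc (batch s c) * s - pos s c + fill c}" for c
    by (auto simp: column_tokens_def board_at_def held_def received_def)
  moreover have "card {batch s c * s - pos s c + fill c <..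
      Suc (batch s c) * s - pos s c + fill c} \<le> s" for c
    by auto
  ultimately have "finite (column_tokens (board_at 0 0) c) \<and>
      card (column_tokens (board_at 0 0) c) \<le> s" for c
    by (meson card_mono finite_greaterThanAtMost finite_subset le_trans)
  then show ?thesis
    by (auto simp: initial_board_def board_at_def held_def received_def)
qed

lemma in_column_counts: "t * s \<in> column_counts n s"
proof -
  define R where "R = (t - 1) * N"
  define v where "v = batch_start s (t - 1)"
  have v: "batch s v = t - 1" "pos s v = 0"
    using batch_eqI[of 0 "t - 1" s] pos_eqI[of 0 "t - 1" s] s_pos by (auto simp: v_def)
  have "batch_start s (Suc (t - 1)) \<le> n" using enough_columns t_pos by simp
  then have vn: "v < n" using s_pos by (simp add: v_def)
  have "reachable n s (board_at (Suc R) 0)"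
  proof -
    obtain P where "(token_step n)\<^sup>*\<^sup>* (board_at 0 0, 0, {}) (board_at (Suc R) 0, 0, P)"
      using steps_to_round[of "Suc R"] by (auto simp: R_def)
    moreover have "0 < n" using vn by simp
    ultimately show ?thesis unfolding reachable_def using initial by blast
  qed
  moreover have "column_tokens (board_at (Suc R) 0) v = {1..t * s}"
  proof -
    have t: "Suc (t - 1) = t" using t_pos by simp
    have "t * N = N + (t - 1) * N" by (metis t mult_Suc)
    \<comment> \<open>The column has been filled in round \<open>R\<close>, but its giving phase has
      not begun.\<close>
    then have R: "Suc R - t * N = 0" using N_pos by (simp add: R_def)
    have fl: "fill v = R" by (simp add: fill_def v R_def)
    have "held (Suc R) i v \<longleftrightarrow> 1 \<le> i \<and> i \<le> t * s" for i
      unfolding held_def fl v t R by simp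
    then have "column_tokens (board_at (Suc R) 0) v = {i. 1 \<le> i \<and> i \<le> t * s}"
      using vn by (simp add: column_tokens_def board_at_def received_def fl)
    also have "\<dots> = {1..t * s}" by auto
    finally show ?thesis .
  qed
  ultimately show ?thesis unfolding column_counts_def using vn
    by (intro CollectI exI[of _ "board_at (Suc R) 0"] exI[of _ v]) simp
qed

end

section \<open>Numerical lower bounds\<close>

lemma ghat_ge: "k \<in> column_counts n s \<Longrightarrow> k \<le> ghat n s"
  unfolding ghat_def by (intro Max_ge finite_column_counts)

lemma ghat_ge_s:
  assumes "n \<ge> 1"
  shows "s \<le> ghat n s"
proof (rule ghat_ge)
  define B :: board where "B = (\<lambda>i u. u = 0 \<and> 1 \<le> i \<and> i \<le> s)"
  have col: "column_tokens B u = (if u = 0 then {1..s} else {})" for u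
    by (auto simp: column_tokens_def B_def)
  have "initial_board n s B" using assms by (auto simp: initial_board_def col) (auto simp: B_def)
  then have "reachable n s B" using assms unfolding reachable_def by (metis One_nat_def Suc_le_eq rtranclp.rtrancl_refl)
  then show "s \<in> column_counts n s"
    unfolding column_counts_def using assms col[of 0]
    by (intro CollectI exI[of _ B] exI[of _ 0]) auto
qed

lemma ghat_lower_bound:
  assumes "n \<ge> 1" "s \<ge> 1"
  shows "real (ghat n s) \<ge> sqrt (2 * real n * real s) - 3 * real s / 2"
proof -
  \<comment> \<open>The number of complete batches among the \<open>n\<close> columns, as column
    \<open>n\<close> is the first one missing.\<close>
  define t where "t = batch s n"
  have le: "batch_start s t \<le> n" by (simp add: t_def batch_start_batch_le)
  have "t * s \<le> ghat n s"
  proof (cases "t \<ge> 1")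
    case True
    then interpret staircase n s t using assms le by unfold_locales auto
    show ?thesis by (rule ghat_ge[OF in_column_counts])
  next
    case False
    then have "t = 0" by simp
    then show ?thesis by simp
  qed
  then have ge: "real t * real s \<le> real (ghat n s)" by (metis of_nat_le_iff of_nat_mult)
  have "n < batch_start s (Suc t)"
    using column_eq[of n s] pos_less[OF assms(2), of n] by (simp add: t_def)
  then have "2 * n \<le> s * Suc t * (Suc t + 1)" using batch_start_eq[of s "Suc t"] by linarith
  then have "2 * real n \<le> real (s * Suc t * (Suc t + 1))" by (metis of_nat_le_iff of_nat_mult of_nat_numeral)
  then have "2 * real n * real s \<le> real (s * Suc t * (Suc t + 1)) * real s"
    by (intro mult_right_mono) auto
  \<comment> \<open>The constant comes from
    \<open>(t + 3/2)^2 = (t + 1) * (t + 2) + 1/4\<close>.\<close>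
  also have "\<dots> \<le> (real t * real s + 3 * real s / 2)\<^sup>2"
    by (simp add: power2_eq_square algebra_simps)
  finally have "sqrt (2 * real n * real s) \<le> real t * real s + 3 * real s / 2"
    by (intro real_le_lsqrt) auto
  then show ?thesis using ge by linarith
qed

theorem theorem3p7:
  "(\<forall>n s :: nat. n \<ge> 1 \<longrightarrow> s \<ge> 1 \<longrightarrow>
      real (ghat n s) \<ge> max (real s) (sqrt (2 * real n * real s) - 3 * real s / 2)) \<and>
   (\<lambda>(n, s). real (ghat n s)) \<in>
      \<Omega>[principal {(n, s). n \<ge> 1 \<and> s \<ge> 1}](\<lambda>(n, s). real s + sqrt (real n * real s))"
proof (intro conjI)
  show *: "\<forall>n s :: nat. n \<ge> 1 \<longrightarrow> s \<ge> 1 \<longrightarrow>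
      real (ghat n s) \<ge> max (real s) (sqrt (2 * real n * real s) - 3 * real s / 2)"
    using ghat_lower_bound ghat_ge_s by simp
  \<comment> \<open>With \<open>g = ghat n s\<close>: \<open>s \<le> g\<close> and
    \<open>sqrt (n * s) \<le> g + 3 * s / 2 \<le> 5 * g / 2\<close> add up to
    \<open>7 * g / 2\<close>.\<close>
  have "2 / 7 * (real s + sqrt (real n * real s)) \<le> real (ghat n s)" if "n \<ge> 1" "s \<ge> 1" for n s
  proof -
    have "sqrt (real n * real s) \<le> sqrt (2 * real n * real s)" by simp
    moreover have "real s \<le> real (ghat n s)"
      "sqrt (2 * real n * real s) - 3 * real s / 2 \<le> real (ghat n s)"
      using * that by auto
    ultimately show ?thesis by argo
  qed
  then show "(\<lambda>(n, s). real (ghat n s)) \<in>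
      \<Omega>[principal {(n, s). n \<ge> 1 \<and> s \<ge> 1}](\<lambda>(n, s). real s + sqrt (real n * real s))"
    by (intro landau_omega.bigI[of "2 / 7"]) (auto simp: eventually_principal)
qed

end
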